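(* Let $f:Q\to\mathbb{R}$ be Lipschitz continuous with constant $M_f>0$ and $\gamma$-quasar convex with center $x_*$, $\gamma\in(0,1]$, and let $g:Q\to\mathbb{R}$ be convex and Lipschitz continuous with constant $M_g>0$, where $x_*$ is a solution of $\min\{f(x): x\in Q,\ g(x)\le 0\}$. Let $\Theta_0>0$ satisfy $\sup_{x,y\in Q}V(y,x)\le\Theta_0^2$, let $\varepsilon>0$ and let $x_0\in Q$ be a starting point. Consider the following algorithm. For $k=0,1,2,\dots$: - if $g(x_k)\le\varepsilon$ (productive step), set $M_k=\|\nabla f(x_k)\|_*$, $h_k=\frac{\gamma\varepsilon}{M_k^2}$, $x_{k+1}=\operatorname{Mirr}_{x_k}(h_k\nabla f(x_k))$; - if $g(x_k)>\varepsilon$ (non-productive step), set $M_k=\|\nabla g(x_k)\|_*$, $h_k=\frac{\gamma\varepsilon}{M_k^2}$, $x_{k+1}=\operatorname{Mirr}_{x_k}(h_k\nabla g(x_k))$. The algorithm stops after the first number $k$ of performed iterations (indexed $0,\dots,k-1$) for which $$\sum_{i=0}^{k-1}\frac1{M_i^2}\ \ge\ \frac{2\Theta_0^2}{\gamma^2\varepsilon^2}\Big(1+\frac1\gamma\Big)^2.$$ Let $I$ be the set of indices of productive steps among $0,\dots,k-1$. Then $I\neq\emptyset$, the algorithm stops after not more than $$\left\lceil\frac{2\Theta_0^2\max\{M_f^2,M_g^2\}}{\gamma^2\varepsilon^2}\Big(1+\frac1\gamma\Big)^2\right\rceil$$ iterations, and it returns $\hat x=\arg\min_{i\in I}f(x_i)$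 (a point $x_i$, $i\in I$, with the smallest value of $f$) such that $f(\hat x)-f(x_* )\le\varepsilon$ and $g(\hat x)\le\varepsilon$.
   Context: $(\mathbf{E},\|\cdot\|)$ is a finite-dimensional normed space with dual $\mathbf{E}^*$ and dual norm $\|y\|_*=\max\{\langle y,x\rangle:\|x\|\le1\}$. $Q\subset\mathbf{E}$ is closed and convex. $d:Q\to\mathbb{R}$ is a proper, closed, differentiable function that is $1$-strongly convex with respect to $\|\cdot\|$ (prox-function). The Bregman divergence is $V(y,x)=d(y)-d(x)-\langle\nabla d(x),y-x\rangle$, $x,y\in Q$; it satisfies $V(y,x)\ge\frac12\|y-x\|^2$. The proximal mapping is $\operatorname{Mirr}_x(p)=\arg\min_{u\in Q}\{\langle p,u\rangle+V(u,x)\}$ for $x\in Q$, $p\in\mathbf{E}^*$. For a function $\phi$ on $Q$, $\nabla\phi(x)\in\partial\phi(x)$ denotes an arbitrary (sub)gradient of $\phi$ at $x$. A function $\phi$ is Lipschitz continuous with constant $M$ if $|\phi(x)-\phi(y)|\le M\|x-y\|$ for all $x,y\in Q$; this is understood to mean also $\|\nabla\phi(x)\|_*\le M$ for all $x\in Q$. For $\gamma\in(0,1]$, $f:Q\to\mathbb{R}$ is $\gamma$-quasar convex with center $x_*\in Q$ if $x_*\in\arg\min_{x\in Q}f(x)$ and $f(x_* )\ge f(x)+\frac1\gamma\langle\nabla f(x),x_*-x\rangle$ for all $x\in Q$. The problem is assumed feasible (regular): there is a point $\bar x$ in the interior of $Q$ with $g(\bar x)\le0$. The step sizes are understood to be well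 defined ($M_k\neq0$ at every iteration). *)

theory Defs
  imports "HOL-Analysis.Analysis"
begin

text \<open>
  The space \<open>E\<close> is a type of class \<open>real_normed_vector\<close> (an arbitrary norm), with
  finite dimension as an explicit hypothesis; the dual is \<open>'a \<Rightarrow>\<^sub>L real\<close>, whose norm is
  the operator norm, i.e. the dual norm.
\<close>

definition finite_dimensional :: "'a::real_vector itself \<Rightarrow> bool" where
  "finite_dimensional _ \<longleftrightarrow> (\<exists>B :: 'a set. finite B \<and> span B = UNIV)"


subsection \<open>Subgradients of functions on a set\<close>

definition convex_subdiff ::
  "'a::real_normed_vector set \<Rightarrow> ('a \<Rightarrow> real) \<Rightarrow> 'a \<Rightarrow> ('a \<Rightarrow>\<^sub>L real) set" where
  "convex_subdiff Q \<phi> x = {p. \<forall>y\<in>Q. \<phi> y \<ge> \<phi> x + blinfun_apply p (y - x)}"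

text \<open>
  A quasar convex function need not be convex, so the inequality above is the wrong notion of
  subgradient for it. For such functions we use the Clarke generalized gradient, relative to the
  domain \<open>Q\<close>: the difference quotients only involve points of \<open>Q\<close>, and only the directions
  \<open>y - x\<close> with \<open>y \<in> Q\<close> are tested. In the interior of \<open>Q\<close> this is the usual Clarke
  generalized gradient. The lemmas below show that it contains gradients and subgradients in the
  sense of convex analysis, and that for a convex Lipschitz function it is the convex
  subdifferential.
\<close>

definition clarke_deriv ::
  "'a::real_normed_vector set \<Rightarrow> ('a \<Rightarrow> real) \<Rightarrow> 'a \<Rightarrow> 'a \<Rightarrow> ereal" where
  "clarke_deriv Q \<phi> x v =
     Limsup (at (x, 0) within {(z, t). z \<in> Q \<and> 0 < t \<and> z + t *\<^sub>R v \<in> Q})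
            (\<lambda>(z, t). ereal ((\<phi> (z + t *\<^sub>R v) - \<phi> z) / t))"

definition clarke_subdiff ::
  "'a::real_normed_vector set \<Rightarrow> ('a \<Rightarrow> real) \<Rightarrow> 'a \<Rightarrow> ('a \<Rightarrow>\<^sub>L real) set" where
  "clarke_subdiff Q \<phi> x =
     {p. \<forall>y\<in>Q. ereal (blinfun_apply p (y - x)) \<le> clarke_deriv Q \<phi> x (y - x)}"

lemma clarke_deriv_lower:
  assumes Q: "convex Q" "x \<in> Q" "y \<in> Q"
    and ev: "\<forall>\<^sub>F t in at_right 0. c \<le> (\<phi> (x + t *\<^sub>R (y - x)) - \<phi> x) / t"
  shows "ereal c \<le> clarke_deriv Q \<phi> x (y - x)"
proof (rule ccontr)
  let ?S = "{(z, t). z \<in> Q \<and> 0 < t \<and> z + t *\<^sub>R (y - x) \<in> Q}"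
  assume "\<not> ?thesis"
  then have "\<forall>\<^sub>F w in at (x, 0) within ?S.
      (case w of (z, t) \<Rightarrow> ereal ((\<phi> (z + t *\<^sub>R (y - x)) - \<phi> z) / t)) < ereal c"
    unfolding clarke_deriv_def by (intro Limsup_lessD) auto
  moreover have "filterlim (\<lambda>t. (x, t)) (at (x, 0) within ?S) (at_right (0::real))"
    unfolding filterlim_at
  proof
    have "\<forall>\<^sub>F t in at_right (0::real). t < 1"
      unfolding eventually_at_right_field by (auto intro: exI[of _ 1])
    moreover have "\<forall>\<^sub>F t in at_right (0::real). 0 < t"
      by (rule eventually_at_right_less)
    ultimately show "\<forall>\<^sub>F t in at_right 0. (x, t) \<in> ?S \<and> (x, t) \<noteq> (x, 0)"
    proof eventually_elim
      case (elim t)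
      have "x + t *\<^sub>R (y - x) = (1 - t) *\<^sub>R x + t *\<^sub>R y" by (simp add: algebra_simps)
      also have "\<dots> \<in> Q" using Q elim by (intro convexD) auto
      finally show ?case using Q elim by auto
    qed
    show "((\<lambda>t. (x, t)) \<longlongrightarrow> (x, 0)) (at_right (0::real))"
      by (intro tendsto_intros)
  qed
  ultimately have "\<forall>\<^sub>F t in at_right 0. ereal ((\<phi> (x + t *\<^sub>R (y - x)) - \<phi> x) / t) < ereal c"
    by (auto dest: eventually_compose_filterlim)
  with ev have "\<forall>\<^sub>F t in at_right (0::real). False"
    by eventually_elim auto
  then show False by simp
qed

lemma convex_subdiff_subset_clarke:
  assumes "convex Q" "x \<in> Q"
  shows "convex_subdiff Q \<phi> x \<subseteq> clarke_subdiff Q \<phi> x"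
proof
  fix p assume p: "p \<in> convex_subdiff Q \<phi> x"
  have "ereal (blinfun_apply p (y - x)) \<le> clarke_deriv Q \<phi> x (y - x)" if y: "y \<in> Q" for y
  proof (rule clarke_deriv_lower[OF assms y])
    have "\<forall>\<^sub>F t in at_right (0::real). 0 < t \<and> t < 1"
      unfolding eventually_at_right_field by (auto intro: exI[of _ 1])
    then show "\<forall>\<^sub>F t in at_right 0.
        blinfun_apply p (y - x) \<le> (\<phi> (x + t *\<^sub>R (y - x)) - \<phi> x) / t"
    proof eventually_elim
      case (elim t)
      have "x + t *\<^sub>R (y - x) = (1 - t) *\<^sub>R x + t *\<^sub>R y" by (simp add: algebra_simps)
      also have "\<dots> \<in> Q" using assms y elim by (intro convexD) auto
      finally have "\<phi> x + blinfun_apply p (t *\<^sub>R (y - x)) \<le> \<phi> (x + t *\<^sub>R (y - x))"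
        using p unfolding convex_subdiff_def by force
      then have "t * blinfun_apply p (y - x) \<le> \<phi> (x + t *\<^sub>R (y - x)) - \<phi> x"
        by (simp only: blinfun.scaleR_right real_scaleR_def)
      then show ?case using elim by (simp add: pos_le_divide_eq mult.commute)
    qed
  qed
  then show "p \<in> clarke_subdiff Q \<phi> x" by (simp add: clarke_subdiff_def)
qed

lemma derivative_in_clarke:
  assumes Q: "convex Q" "x \<in> Q" and D: "(\<phi> has_derivative blinfun_apply p) (at x within Q)"
  shows "p \<in> clarke_subdiff Q \<phi> x"
proof -
  have "ereal (blinfun_apply p (y - x)) \<le> clarke_deriv Q \<phi> x (y - x)" if y: "y \<in> Q" for y
  proof (rule ereal_le_epsilon2)
    fix e :: real assume e: "0 < e"
    have "((\<lambda>t. x + t *\<^sub>R (y - x)) has_derivative (\<lambda>t. t *\<^sub>R (y - x))) (at 0 within {0..1})"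
      by (auto intro!: derivative_eq_intros)
    moreover have "(\<lambda>t. x + t *\<^sub>R (y - x)) ` {0..1} \<subseteq> Q"
    proof clarsimp
      fix t :: real assume t: "0 \<le> t" "t \<le> 1"
      have "x + t *\<^sub>R (y - x) = (1 - t) *\<^sub>R x + t *\<^sub>R y" by (simp add: algebra_simps)
      also have "\<dots> \<in> Q" using Q y t by (intro convexD) auto
      finally show "x + t *\<^sub>R (y - x) \<in> Q" .
    qed
    then have "(\<phi> has_derivative blinfun_apply p)
        (at (x + 0 *\<^sub>R (y - x)) within (\<lambda>t. x + t *\<^sub>R (y - x)) ` {0..1})"
      using has_derivative_subset[OF D] by (simp only: scaleR_zero_left add_0_right)
    ultimately have "((\<lambda>t. \<phi> (x + t *\<^sub>R (y - x))) has_derivative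
        (\<lambda>t. blinfun_apply p (t *\<^sub>R (y - x)))) (at 0 within {0..1})"
      by (rule has_derivative_in_compose)
    then have "((\<lambda>t. \<phi> (x + t *\<^sub>R (y - x))) has_field_derivative blinfun_apply p (y - x))
        (at 0 within {0..1})"
      unfolding has_field_derivative_def
      by (rule has_derivative_eq_rhs) (simp add: fun_eq_iff blinfun.scaleR_right)
    then have "((\<lambda>t. (\<phi> (x + t *\<^sub>R (y - x)) - \<phi> x) / t) \<longlongrightarrow> blinfun_apply p (y - x))
        (at_right 0)"
      by (simp add: has_field_derivative_iff at_within_Icc_at_right)
    then have "\<forall>\<^sub>F t in at_right 0.
        blinfun_apply p (y - x) - e < (\<phi> (x + t *\<^sub>R (y - x)) - \<phi> x) / t"
      by (rule order_tendstoD) (use e in simp)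
    then have "ereal (blinfun_apply p (y - x) - e) \<le> clarke_deriv Q \<phi> x (y - x)"
      by (intro clarke_deriv_lower Q y) (auto elim: eventually_mono)
    then show "ereal (blinfun_apply p (y - x)) \<le> clarke_deriv Q \<phi> x (y - x) + ereal e"
      by (cases "clarke_deriv Q \<phi> x (y - x)") auto
  qed
  then show ?thesis by (simp add: clarke_subdiff_def)
qed

lemma clarke_subdiff_convex:
  assumes cvx: "convex_on Q \<phi>" and x: "x \<in> Q" and lip: "M-lipschitz_on Q \<phi>"
  shows "clarke_subdiff Q \<phi> x = convex_subdiff Q \<phi> x"
proof
  have Q: "convex Q" using cvx by (simp add: convex_on_def)
  have M: "M \<ge> 0" using lip by (rule lipschitz_on_nonneg)
  show "convex_subdiff Q \<phi> x \<subseteq> clarke_subdiff Q \<phi> x"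
    by (rule convex_subdiff_subset_clarke[OF Q x])
  have le: "clarke_deriv Q \<phi> x (y - x) \<le> ereal (\<phi> y - \<phi> x)" if y: "y \<in> Q" for y
  proof (rule ereal_le_epsilon2)
    fix e :: real assume e: "0 < e"
    let ?S = "{(z, t). z \<in> Q \<and> 0 < t \<and> z + t *\<^sub>R (y - x) \<in> Q}"
    define r where "r = min 1 (e / (2 * M + 1))"
    have r: "0 < r" "r \<le> 1" "2 * M * r \<le> e"
    proof -
      show "0 < r" "r \<le> 1" using e M by (auto simp: r_def)
      have "2 * M * r \<le> (2 * M + 1) * (e / (2 * M + 1))"
        using e M by (intro mult_mono) (auto simp: r_def)
      then show "2 * M * r \<le> e" using M by simp
    qed
    have "\<forall>\<^sub>F w in at (x, 0) within ?S.
        (case w of (z, t) \<Rightarrow> ereal ((\<phi> (z + t *\<^sub>R (y - x)) - \<phi> z) / t)) \<le> ereal (\<phi> y - \<phi> x + e)"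
      unfolding eventually_at
    proof (intro exI[of _ r] conjI ballI impI r(1))
      fix w assume w: "w \<in> ?S" and dw: "w \<noteq> (x, 0) \<and> dist w (x, 0) < r"
      obtain z t where zt: "w = (z, t)" by (cases w)
      have z: "z \<in> Q" and t: "0 < t" and zt': "z + t *\<^sub>R (y - x) \<in> Q" using w zt by auto
      have dz: "dist z x < r" and "dist t 0 < r"
        using dw dist_fst_le[of w "(x, 0)"] dist_snd_le[of w "(x, 0)"] zt by auto
      then have t1: "t \<le> 1" using r by auto
      have u: "(1 - t) *\<^sub>R z + t *\<^sub>R y \<in> Q" using Q z y t t1 by (intro convexD) auto
      have "\<phi> (z + t *\<^sub>R (y - x)) - \<phi> ((1 - t) *\<^sub>R z + t *\<^sub>R y)
          \<le> M * dist (z + t *\<^sub>R (y - x)) ((1 - t) *\<^sub>R z + t *\<^sub>R y)"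
        using lipschitz_onD[OF lip zt' u] by (simp add: dist_real_def)
      also have "dist (z + t *\<^sub>R (y - x)) ((1 - t) *\<^sub>R z + t *\<^sub>R y) = norm (t *\<^sub>R (z - x))"
        unfolding dist_norm by (rule arg_cong[where f = norm]) (simp add: algebra_simps)
      also have "\<dots> = t * dist z x" using t by (simp add: dist_norm)
      finally have a1: "\<phi> (z + t *\<^sub>R (y - x)) \<le> \<phi> ((1 - t) *\<^sub>R z + t *\<^sub>R y) + M * (t * dist z x)"
        by simp
      have a2: "\<phi> ((1 - t) *\<^sub>R z + t *\<^sub>R y) \<le> (1 - t) * \<phi> z + t * \<phi> y"
        using cvx z y t t1 unfolding convex_on_def by auto
      have a3: "\<phi> x - \<phi> z \<le> M * dist z x"
        using lipschitz_onD[OF lip z x] by (simp add: dist_real_def)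
      have a4: "M * dist z x \<le> M * r" using dz M by (intro mult_left_mono) auto
      have "\<phi> (z + t *\<^sub>R (y - x)) - \<phi> z \<le> t * (\<phi> y - \<phi> z + M * dist z x)"
        using a1 a2 by (simp add: algebra_simps)
      also have "\<dots> \<le> t * (\<phi> y - \<phi> x + e)"
        using a3 a4 r t by (intro mult_left_mono) auto
      finally show "(case w of (z, t) \<Rightarrow> ereal ((\<phi> (z + t *\<^sub>R (y - x)) - \<phi> z) / t))
          \<le> ereal (\<phi> y - \<phi> x + e)"
        using zt t by (simp add: pos_divide_le_eq mult.commute)
    qed
    then show "clarke_deriv Q \<phi> x (y - x) \<le> ereal (\<phi> y - \<phi> x) + ereal e"
      unfolding clarke_deriv_def by (simp add: Limsup_bounded)
  qed
  show "clarke_subdiff Q \<phi> x \<subseteq> convex_subdiff Q \<phi> x"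
  proof
    fix p assume p: "p \<in> clarke_subdiff Q \<phi> x"
    have "\<phi> y \<ge> \<phi> x + blinfun_apply p (y - x)" if y: "y \<in> Q" for y
    proof -
      have "ereal (blinfun_apply p (y - x)) \<le> clarke_deriv Q \<phi> x (y - x)"
        using p y unfolding clarke_subdiff_def by blast
      also note le[OF y]
      finally have "ereal (blinfun_apply p (y - x)) \<le> ereal (\<phi> y - \<phi> x)" .
      then show ?thesis by simp
    qed
    then show "p \<in> convex_subdiff Q \<phi> x" by (simp add: convex_subdiff_def)
  qed
qed


subsection \<open>Quasar convexity\<close>

definition quasar_convex_on ::
  "real \<Rightarrow> 'a::real_normed_vector \<Rightarrow> 'a set \<Rightarrow> ('a \<Rightarrow> real) \<Rightarrow> ('a \<Rightarrow> 'a \<Rightarrow>\<^sub>L real) \<Rightarrow> bool" where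
  "quasar_convex_on \<gamma> xs Q f gradf \<longleftrightarrow>
     is_arg_min f (\<lambda>x. x \<in> Q) xs \<and>
     (\<forall>x\<in>Q. f xs \<ge> f x + 1 / \<gamma> * blinfun_apply (gradf x) (xs - x))"


subsection \<open>Prox-function, Bregman divergence, proximal mapping\<close>

definition strongly_convex_on ::
  "real \<Rightarrow> 'a::real_normed_vector set \<Rightarrow> ('a \<Rightarrow> real) \<Rightarrow> bool" where
  "strongly_convex_on \<mu> Q d \<longleftrightarrow> convex Q \<and>
     (\<forall>x\<in>Q. \<forall>y\<in>Q. \<forall>t\<in>{0..1}.
        d (t *\<^sub>R x + (1 - t) *\<^sub>R y)
          \<le> t * d x + (1 - t) * d y - \<mu> / 2 * t * (1 - t) * (norm (x - y))\<^sup>2)"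

text \<open>
  Since \<open>d\<close> is real-valued on \<open>Q\<close>, it is proper iff \<open>Q\<close> is nonempty.
\<close>

definition prox_function :: "'a::real_normed_vector set \<Rightarrow> ('a \<Rightarrow> real) \<Rightarrow> bool" where
  "prox_function Q d \<longleftrightarrow>
     Q \<noteq> {} \<and> closed (epigraph Q d) \<and> d differentiable_on Q \<and> strongly_convex_on 1 Q d"

text \<open>
  \<open>\<nabla>d(x)\<close> is the derivative relative to \<open>Q\<close>. It is unique when \<open>Q\<close> is convex with nonempty
  interior.
\<close>

definition bregman :: "'a::real_normed_vector set \<Rightarrow> ('a \<Rightarrow> real) \<Rightarrow> 'a \<Rightarrow> 'a \<Rightarrow> real" where
  "bregman Q d y x = d y - d x - frechet_derivative d (at x within Q) (y - x)"

text \<open>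
  The proximal mapping as the set of minimizers; it has at most one element by strong convexity.
\<close>

definition Mirr ::
  "'a::real_normed_vector set \<Rightarrow> ('a \<Rightarrow> real) \<Rightarrow> 'a \<Rightarrow> ('a \<Rightarrow>\<^sub>L real) \<Rightarrow> 'a set" where
  "Mirr Q d x p = {u. is_arg_min (\<lambda>u. blinfun_apply p u + bregman Q d u x) (\<lambda>u. u \<in> Q) u}"


subsection \<open>The algorithm\<close>

definition step_grad ::
  "('a::real_normed_vector \<Rightarrow> 'a \<Rightarrow>\<^sub>L real) \<Rightarrow> ('a \<Rightarrow> real) \<Rightarrow> ('a \<Rightarrow> 'a \<Rightarrow>\<^sub>L real) \<Rightarrow> real
     \<Rightarrow> 'a \<Rightarrow> 'a \<Rightarrow>\<^sub>L real" where
  "step_grad gradf g gradg \<epsilon> u = (if g u \<le> \<epsilon> then gradf u else gradg u)"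

definition md_step ::
  "'a::real_normed_vector set \<Rightarrow> ('a \<Rightarrow> real) \<Rightarrow> ('a \<Rightarrow> 'a \<Rightarrow>\<^sub>L real) \<Rightarrow> ('a \<Rightarrow> real)
     \<Rightarrow> ('a \<Rightarrow> 'a \<Rightarrow>\<^sub>L real) \<Rightarrow> real \<Rightarrow> real \<Rightarrow> 'a \<Rightarrow> 'a \<Rightarrow> bool" where
  "md_step Q d gradf g gradg \<gamma> \<epsilon> u u' \<longleftrightarrow>
     (let p = step_grad gradf g gradg \<epsilon> u; M = norm p; h = \<gamma> * \<epsilon> / M\<^sup>2
      in M \<noteq> 0 \<and> u' \<in> Mirr Q d u (h *\<^sub>R p))"

definition stop_crit ::
  "('a::real_normed_vector \<Rightarrow> 'a \<Rightarrow>\<^sub>L real) \<Rightarrow> ('a \<Rightarrow> real) \<Rightarrow> ('a \<Rightarrow> 'a \<Rightarrow>\<^sub>L real)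
     \<Rightarrow> real \<Rightarrow> real \<Rightarrow> real \<Rightarrow> (nat \<Rightarrow> 'a) \<Rightarrow> nat \<Rightarrow> bool" where
  "stop_crit gradf g gradg \<gamma> \<epsilon> \<Theta> x k \<longleftrightarrow>
     (\<Sum>i<k. 1 / (norm (step_grad gradf g gradg \<epsilon> (x i)))\<^sup>2)
       \<ge> 2 * \<Theta>\<^sup>2 / (\<gamma>\<^sup>2 * \<epsilon>\<^sup>2) * (1 + 1 / \<gamma>)\<^sup>2"

text \<open>
  Iteration \<open>k\<close>, which computes \<open>x (k + 1)\<close>, is performed iff the stopping criterion has not been
  met after any number \<open>j \<le> k\<close> of iterations. Nothing is required of \<open>x\<close> after the algorithm has
  stopped.
\<close>

definition md_run ::
  "'a::real_normed_vector set \<Rightarrow> ('a \<Rightarrow> real) \<Rightarrow> ('a \<Rightarrow> 'a \<Rightarrow>\<^sub>L real) \<Rightarrow> ('a \<Rightarrow> real)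
     \<Rightarrow> ('a \<Rightarrow> 'a \<Rightarrow>\<^sub>L real) \<Rightarrow> real \<Rightarrow> real \<Rightarrow> real \<Rightarrow> (nat \<Rightarrow> 'a) \<Rightarrow> bool" where
  "md_run Q d gradf g gradg \<gamma> \<epsilon> \<Theta> x \<longleftrightarrow>
     x 0 \<in> Q \<and>
     (\<forall>k. (\<forall>j\<le>k. \<not> stop_crit gradf g gradg \<gamma> \<epsilon> \<Theta> x j)
        \<longrightarrow> md_step Q d gradf g gradg \<gamma> \<epsilon> (x k) (x (Suc k)))"

definition stops_after ::
  "('a::real_normed_vector \<Rightarrow> 'a \<Rightarrow>\<^sub>L real) \<Rightarrow> ('a \<Rightarrow> real) \<Rightarrow> ('a \<Rightarrow> 'a \<Rightarrow>\<^sub>L real)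
     \<Rightarrow> real \<Rightarrow> real \<Rightarrow> real \<Rightarrow> (nat \<Rightarrow> 'a) \<Rightarrow> nat \<Rightarrow> bool" where
  "stops_after gradf g gradg \<gamma> \<epsilon> \<Theta> x k \<longleftrightarrow>
     stop_crit gradf g gradg \<gamma> \<epsilon> \<Theta> x k \<and> (\<forall>j<k. \<not> stop_crit gradf g gradg \<gamma> \<epsilon> \<Theta> x j)"

definition productive :: "('a \<Rightarrow> real) \<Rightarrow> real \<Rightarrow> (nat \<Rightarrow> 'a) \<Rightarrow> nat \<Rightarrow> nat set" where
  "productive g \<epsilon> x k = {i. i < k \<and> g (x i) \<le> \<epsilon>}"

definition md_output ::
  "('a \<Rightarrow> real) \<Rightarrow> ('a \<Rightarrow> real) \<Rightarrow> real \<Rightarrow> (nat \<Rightarrow> 'a) \<Rightarrow> nat \<Rightarrow> 'a set" where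
  "md_output f g \<epsilon> x k = {u. is_arg_min f (\<lambda>u. u \<in> x ` productive g \<epsilon> x k) u}"

end

theory Submission
  imports Defs
begin

text \<open>
  One mirror descent step with step size \<open>h\<close> along \<open>p\<close> from \<open>u\<close> to \<open>u'\<close> satisfies
  \<open>h \<langle>p, u - y\<rangle> \<le> h\<^sup>2 \<parallel>p\<parallel>\<^sup>2 / 2 + V(y,u) - V(y,u')\<close> for every \<open>y \<in> Q\<close>, which
  comes from first-order optimality of \<open>u'\<close> and \<open>V(u',u) \<ge> \<parallel>u' - u\<parallel>\<^sup>2 / 2\<close>
  (\<open>mirror_step_inequality\<close>).

  Call a step bad if it is non-productive, or productive with \<open>f u - f x\<^sub>* \<ge> \<epsilon>\<close>. At a bad step
  \<open>\<langle>p, u - x\<^sub>*\<rangle> \<ge> \<gamma> \<epsilon>\<close>: by quasar convexity if the step is productive, and by convexity of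
  \<open>g\<close>, \<open>g x\<^sub>* \<le> 0\<close> and \<open>\<gamma> \<le> 1\<close> otherwise (\<open>bad_step_gap\<close>). The choice
  \<open>h = \<gamma> \<epsilon> / \<parallel>p\<parallel>\<^sup>2\<close> maximizes \<open>h \<gamma> \<epsilon> - h\<^sup>2 \<parallel>p\<parallel>\<^sup>2 / 2\<close>, so each bad step brings the potential
  \<open>V(x\<^sub>*, \<cdot>)\<close> down by at least \<open>\<gamma>\<^sup>2 \<epsilon>\<^sup>2 / (2 \<parallel>p\<parallel>\<^sup>2)\<close>. The potential lies between \<open>0\<close> and
  \<open>\<Theta>\<^sub>0\<^sup>2\<close>; hence, if all steps are bad, the sum of the \<open>1 / M\<^sub>i\<^sup>2\<close> is at most
  \<open>2 \<Theta>\<^sub>0\<^sup>2 / (\<gamma>\<^sup>2 \<epsilon>\<^sup>2)\<close> (\<open>bad_steps_bound\<close>). The stopping criterion asks for at least four times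
  this value, so when it holds some step is not bad: this step is productive and its
  point is \<open>\<epsilon>\<close>-optimal, and the best productive point is at least as good.

  Termination is a count: every summand \<open>1 / M\<^sub>i\<^sup>2\<close> is at least \<open>1 / max (M\<^sub>f\<^sup>2) (M\<^sub>g\<^sup>2)\<close>.
\<close>

section \<open>Bregman divergence and the proximal mapping\<close>

lemma difference_quotient_tendsto:
  assumes Q: "convex Q" "x \<in> Q" "y \<in> Q" and D: "(\<phi> has_derivative \<phi>') (at x within Q)"
  shows "((\<lambda>t. (\<phi> (x + t *\<^sub>R (y - x)) - \<phi> x) / t) \<longlongrightarrow> \<phi>' (y - x)) (at_right 0)"
proof -
  have "((\<lambda>t. x + t *\<^sub>R (y - x)) has_derivative (\<lambda>t. t *\<^sub>R (y - x))) (at 0 within {0..1})"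
    by (auto intro!: derivative_eq_intros)
  moreover have "(\<lambda>t. x + t *\<^sub>R (y - x)) ` {0..1} \<subseteq> Q"
    using Q by (force simp: convex_alt algebra_simps)
  then have "(\<phi> has_derivative \<phi>') (at (x + 0 *\<^sub>R (y - x)) within (\<lambda>t. x + t *\<^sub>R (y - x)) ` {0..1})"
    using has_derivative_subset[OF D] by simp
  ultimately have "((\<lambda>t. \<phi> (x + t *\<^sub>R (y - x))) has_derivative (\<lambda>t. \<phi>' (t *\<^sub>R (y - x))))
      (at 0 within {0..1})"
    by (rule has_derivative_in_compose)
  moreover have "(\<lambda>t. \<phi>' (t *\<^sub>R (y - x))) = (*) (\<phi>' (y - x))"
    using linear_scale[OF has_derivative_linear[OF D]] by (simp add: fun_eq_iff mult.commute)
  ultimately have "((\<lambda>t. \<phi> (x + t *\<^sub>R (y - x))) has_field_derivative \<phi>' (y - x)) (at 0 within {0..1})"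
    by (simp add: has_field_derivative_def)
  then show ?thesis
    by (simp add: has_field_derivative_iff at_within_Icc_at_right)
qed

lemma eventually_at_right_unit: "\<forall>\<^sub>F t in at_right (0::real). 0 < t \<and> t < 1"
  unfolding eventually_at_right_field by (auto intro: exI[of _ 1])

lemma prox_function_has_derivative:
  assumes "prox_function Q d" and "x \<in> Q"
  shows "(d has_derivative frechet_derivative d (at x within Q)) (at x within Q)"
  using assms by (simp add: prox_function_def differentiable_on_def frechet_derivative_works)

text \<open>
  Strong convexity bounds the difference quotient of \<open>d\<close> from \<open>x\<close> towards \<open>y\<close> at parameter
  \<open>t\<close> by \<open>d y - d x - (1 - t) \<parallel>y - x\<parallel>\<^sup>2 / 2\<close>; the bound is its limit for \<open>t \<rightarrow> 0\<close>.
\<close>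

lemma bregman_lower_bound:
  assumes d: "prox_function Q d" and x: "x \<in> Q" and y: "y \<in> Q"
  shows "bregman Q d y x \<ge> (norm (y - x))\<^sup>2 / 2"
proof -
  have sc: "strongly_convex_on 1 Q d" and Q: "convex Q"
    using d by (auto simp: prox_function_def strongly_convex_on_def)
  let ?D = "frechet_derivative d (at x within Q)"
  have "?D (y - x) \<le> d y - d x - (1 - 0) * (norm (y - x))\<^sup>2 / 2"
  proof (rule tendsto_le)
    show "((\<lambda>t. (d (x + t *\<^sub>R (y - x)) - d x) / t) \<longlongrightarrow> ?D (y - x)) (at_right 0)"
      by (rule difference_quotient_tendsto[OF Q x y prox_function_has_derivative[OF d x]])
    show "((\<lambda>t::real. d y - d x - (1 - t) * (norm (y - x))\<^sup>2 / 2)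
        \<longlongrightarrow> d y - d x - (1 - 0) * (norm (y - x))\<^sup>2 / 2) (at_right 0)"
      by (intro tendsto_intros) auto
    show "\<forall>\<^sub>F t in at_right 0.
        (d (x + t *\<^sub>R (y - x)) - d x) / t \<le> d y - d x - (1 - t) * (norm (y - x))\<^sup>2 / 2"
      using eventually_at_right_unit
    proof eventually_elim
      case (elim t)
      have "d (t *\<^sub>R y + (1 - t) *\<^sub>R x)
          \<le> t * d y + (1 - t) * d x - 1 / 2 * t * (1 - t) * (norm (y - x))\<^sup>2"
        using sc x y elim by (simp add: strongly_convex_on_def)
      moreover have "t *\<^sub>R y + (1 - t) *\<^sub>R x = x + t *\<^sub>R (y - x)"
        by (simp add: algebra_simps)
      ultimately have "d (x + t *\<^sub>R (y - x)) - d x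
          \<le> (d y - d x - (1 - t) * (norm (y - x))\<^sup>2 / 2) * t"
        by (simp add: algebra_simps)
      then show ?case using elim by (simp add: pos_divide_le_eq)
    qed
  qed simp
  then show ?thesis by (simp add: bregman_def)
qed

lemma Mirr_in: "u \<in> Mirr Q d x p \<Longrightarrow> u \<in> Q"
  by (simp add: Mirr_def is_arg_min_def)

text \<open>
  First-order optimality: the minimized function has nonnegative difference quotients at \<open>u\<close> in
  every direction \<open>y - u\<close> that stays in \<open>Q\<close>.
\<close>

lemma Mirr_optimality:
  assumes d: "prox_function Q d" and x: "x \<in> Q" and y: "y \<in> Q" and u: "u \<in> Mirr Q d x p"
  shows "blinfun_apply p (y - u) + frechet_derivative d (at u within Q) (y - u)
           - frechet_derivative d (at x within Q) (y - u) \<ge> 0"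
proof -
  let ?Du = "frechet_derivative d (at u within Q)" and ?Dx = "frechet_derivative d (at x within Q)"
  let ?F = "\<lambda>v. blinfun_apply p v + bregman Q d v x"
  have Q: "convex Q" using d by (simp add: prox_function_def strongly_convex_on_def)
  have uQ: "u \<in> Q" using u by (rule Mirr_in)
  have min: "?F u \<le> ?F v" if "v \<in> Q" for v
    using u that by (force simp: Mirr_def is_arg_min_def)
  have lin: "linear ?Dx"
    by (rule has_derivative_linear[OF prox_function_has_derivative[OF d x]])
  have "(?Dx has_derivative ?Dx) (at u within Q)"
    by (rule has_derivative_at_withinI, rule bounded_linear_imp_has_derivative,
        rule has_derivative_bounded_linear[OF prox_function_has_derivative[OF d x]])
  moreover have "?F = (\<lambda>v. blinfun_apply p v + (d v - d x - (?Dx v - ?Dx x)))"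
    by (simp add: bregman_def linear_diff[OF lin])
  ultimately have "(?F has_derivative
      (\<lambda>v. blinfun_apply p v + (?Du v - ?Dx v))) (at u within Q)"
    using prox_function_has_derivative[OF d uQ] by (auto intro!: derivative_eq_intros)
  from difference_quotient_tendsto[OF Q uQ y this]
  have "((\<lambda>t. (?F (u + t *\<^sub>R (y - u)) - ?F u) / t)
      \<longlongrightarrow> blinfun_apply p (y - u) + (?Du (y - u) - ?Dx (y - u))) (at_right 0)" .
  then have "0 \<le> blinfun_apply p (y - u) + (?Du (y - u) - ?Dx (y - u))"
  proof (rule tendsto_lowerbound)
    show "\<forall>\<^sub>F t in at_right 0. 0 \<le> (?F (u + t *\<^sub>R (y - u)) - ?F u) / t"
      using eventually_at_right_unit
    proof eventually_elim
      case (elim t)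
      have "u + t *\<^sub>R (y - u) = (1 - t) *\<^sub>R u + t *\<^sub>R y" by (simp add: algebra_simps)
      also have "\<dots> \<in> Q" using Q uQ y elim by (intro convexD) auto
      finally show ?case using min[of "u + t *\<^sub>R (y - u)"] elim by (intro divide_nonneg_pos) auto
    qed
  qed simp
  then show ?thesis by simp
qed

text \<open>
  Optimality of \<open>u\<close> and the three-point identity
  \<open>V(y,x) - V(y,u) - V(u,x) = (\<nabla>d(u) - \<nabla>d(x)) (y - u)\<close> give
  \<open>p (u - y) \<le> V(y,x) - V(y,u) - V(u,x)\<close>. The remaining \<open>p (x - u)\<close> is at most
  \<open>\<parallel>p\<parallel>\<^sup>2 / 2 + \<parallel>x - u\<parallel>\<^sup>2 / 2\<close>, and \<open>V(u,x)\<close> absorbs the second term.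
\<close>

lemma mirror_step_inequality:
  assumes d: "prox_function Q d" and x: "x \<in> Q" and y: "y \<in> Q" and u: "u \<in> Mirr Q d x p"
  shows "blinfun_apply p (x - y) \<le> (norm p)\<^sup>2 / 2 + bregman Q d y x - bregman Q d y u"
proof -
  let ?Du = "frechet_derivative d (at u within Q)" and ?Dx = "frechet_derivative d (at x within Q)"
  have uQ: "u \<in> Q" using u by (rule Mirr_in)
  have lin: "linear ?Dx"
    by (rule has_derivative_linear[OF prox_function_has_derivative[OF d x]])
  have "bregman Q d y x - bregman Q d y u - bregman Q d u x = ?Du (y - u) - ?Dx (y - u)"
    by (simp add: bregman_def linear_diff[OF lin])
  then have "blinfun_apply p (u - y) \<le> bregman Q d y x - bregman Q d y u - bregman Q d u x"
    using Mirr_optimality[OF d x y u] by (simp add: blinfun.diff_right)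
  moreover have "blinfun_apply p (x - u) \<le> (norm p)\<^sup>2 / 2 + (norm (u - x))\<^sup>2 / 2"
  proof -
    have "blinfun_apply p (x - u) \<le> norm p * norm (u - x)"
      using norm_blinfun[of p "x - u"] by (simp add: norm_minus_commute)
    also have "\<dots> \<le> (norm p)\<^sup>2 / 2 + (norm (u - x))\<^sup>2 / 2"
      using sum_squares_bound[of "norm p" "norm (u - x)"] by simp
    finally show ?thesis .
  qed
  moreover have "blinfun_apply p (x - y) = blinfun_apply p (x - u) + blinfun_apply p (u - y)"
    by (simp add: blinfun.diff_right)
  ultimately show ?thesis
    using bregman_lower_bound[OF d x uQ] by linarith
qed

section \<open>Progress at bad steps\<close>

text \<open>
  With \<open>h = \<gamma> \<epsilon> / \<parallel>p\<parallel>\<^sup>2\<close>, both the gain \<open>h \<gamma> \<epsilon>\<close> and the loss \<open>\<parallel>h p\<parallel>\<^sup>2 / 2\<close> are multiples of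
  \<open>\<gamma>\<^sup>2 \<epsilon>\<^sup>2 / \<parallel>p\<parallel>\<^sup>2\<close>, with factors \<open>1\<close> and \<open>1 / 2\<close>.
\<close>

lemma md_step_progress:
  assumes d: "prox_function Q d" and u: "u \<in> Q" and y: "y \<in> Q"
    and pos: "0 < \<gamma>" "0 < \<epsilon>"
    and step: "md_step Q d gradf g gradg \<gamma> \<epsilon> u u'"
    and gap: "\<gamma> * \<epsilon> \<le> blinfun_apply (step_grad gradf g gradg \<epsilon> u) (u - y)"
  shows "\<gamma>\<^sup>2 * \<epsilon>\<^sup>2 / 2 * (1 / (norm (step_grad gradf g gradg \<epsilon> u))\<^sup>2)
           \<le> bregman Q d y u - bregman Q d y u'"
proof -
  define p where "p = step_grad gradf g gradg \<epsilon> u"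
  define h where "h = \<gamma> * \<epsilon> / (norm p)\<^sup>2"
  have np: "norm p > 0" and u': "u' \<in> Mirr Q d u (h *\<^sub>R p)"
    using step by (auto simp: md_step_def p_def h_def Let_def)
  have hp: "h \<ge> 0" using pos by (simp add: h_def)
  have "h * (\<gamma> * \<epsilon>) \<le> h * blinfun_apply p (u - y)"
    using gap hp by (intro mult_left_mono) (auto simp: p_def)
  also have "\<dots> = blinfun_apply (h *\<^sub>R p) (u - y)"
    by (simp add: blinfun.scaleR_left)
  also have "\<dots> \<le> (norm (h *\<^sub>R p))\<^sup>2 / 2 + bregman Q d y u - bregman Q d y u'"
    by (rule mirror_step_inequality[OF d u y u'])
  also have "(norm (h *\<^sub>R p))\<^sup>2 = h * (\<gamma> * \<epsilon>)"
    using np by (simp add: power_mult_distrib h_def power2_eq_square)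
  also have "h * (\<gamma> * \<epsilon>) = \<gamma>\<^sup>2 * \<epsilon>\<^sup>2 * (1 / (norm p)\<^sup>2)"
    by (simp add: h_def power2_eq_square)
  finally show ?thesis by (simp add: p_def)
qed

lemma bad_step_gap:
  assumes g: "0 < \<gamma>" "\<gamma> \<le> 1" "0 < \<epsilon>"
    and qc: "quasar_convex_on \<gamma> xs Q f gradf"
    and sub: "gradg u \<in> convex_subdiff Q g u"
    and u: "u \<in> Q" and xs: "xs \<in> Q" "g xs \<le> 0"
    and bad: "g u \<le> \<epsilon> \<Longrightarrow> \<epsilon> \<le> f u - f xs"
  shows "\<gamma> * \<epsilon> \<le> blinfun_apply (step_grad gradf g gradg \<epsilon> u) (u - xs)"
proof (cases "g u \<le> \<epsilon>")
  case True
  have "f xs \<ge> f u + 1 / \<gamma> * blinfun_apply (gradf u) (xs - u)"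
    using qc u by (simp add: quasar_convex_on_def)
  then have "\<epsilon> \<le> 1 / \<gamma> * blinfun_apply (gradf u) (u - xs)"
    using bad[OF True] by (simp add: blinfun.diff_right diff_divide_distrib)
  then show ?thesis using g True by (simp add: step_grad_def field_simps)
next
  case False
  have "g xs \<ge> g u + blinfun_apply (gradg u) (xs - u)"
    using sub xs by (simp add: convex_subdiff_def)
  then have "\<epsilon> \<le> blinfun_apply (gradg u) (u - xs)"
    using False xs by (simp add: blinfun.diff_right)
  moreover have "\<gamma> * \<epsilon> \<le> \<epsilon>" using g by (simp add: mult_left_le_one_le)
  ultimately show ?thesis using False by (simp add: step_grad_def)
qed

lemma md_steps_in:
  assumes "x 0 \<in> Q" and "\<And>i. i < k \<Longrightarrow> md_step Q d gradf g gradg \<gamma> \<epsilon> (x i) (x (Suc i))"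
    and "i \<le> k"
  shows "x i \<in> Q"
proof (cases i)
  case (Suc j)
  then show ?thesis using assms(2)[of j] assms(3) by (auto simp: md_step_def Let_def dest: Mirr_in)
qed (use assms(1) in simp)

text \<open>
  The decrease of \<open>V(y, \<cdot>)\<close> telescopes, and what remains at the end is nonnegative.
\<close>

lemma bad_steps_bound:
  assumes d: "prox_function Q d" and y: "y \<in> Q" and pos: "0 < \<gamma>" "0 < \<epsilon>"
    and x0: "x 0 \<in> Q"
    and step: "\<And>i. i < k \<Longrightarrow> md_step Q d gradf g gradg \<gamma> \<epsilon> (x i) (x (Suc i))"
    and gap: "\<And>i. i < k \<Longrightarrow>
      \<gamma> * \<epsilon> \<le> blinfun_apply (step_grad gradf g gradg \<epsilon> (x i)) (x i - y)"
  shows "(\<Sum>i<k. 1 / (norm (step_grad gradf g gradg \<epsilon> (x i)))\<^sup>2)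
           \<le> 2 * bregman Q d y (x 0) / (\<gamma>\<^sup>2 * \<epsilon>\<^sup>2)"
proof -
  let ?N = "\<lambda>i. 1 / (norm (step_grad gradf g gradg \<epsilon> (x i)))\<^sup>2"
  have xQ: "x i \<in> Q" if "i \<le> k" for i using md_steps_in[OF x0 step that] .
  have "\<gamma>\<^sup>2 * \<epsilon>\<^sup>2 / 2 * (\<Sum>i<k. ?N i) = (\<Sum>i<k. \<gamma>\<^sup>2 * \<epsilon>\<^sup>2 / 2 * ?N i)"
    by (rule sum_distrib_left)
  also have "\<dots> \<le> (\<Sum>i<k. bregman Q d y (x i) - bregman Q d y (x (Suc i)))"
    using md_step_progress[OF d xQ y pos step gap] by (intro sum_mono) simp
  also have "\<dots> = bregman Q d y (x 0) - bregman Q d y (x k)"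
    by (rule sum_lessThan_telescope')
  also have "\<dots> \<le> bregman Q d y (x 0)"
  proof -
    have "0 \<le> (norm (y - x k))\<^sup>2 / 2" by simp
    then show ?thesis using bregman_lower_bound[OF d xQ[OF order_refl] y] by linarith
  qed
  finally show ?thesis using pos by (simp add: pos_le_divide_eq mult.commute)
qed

section \<open>Termination and accuracy\<close>

text \<open>
  While the algorithm runs, each summand of the stopping criterion is at least \<open>1 / B\<close>, and \<open>N\<close>
  such summands reach the threshold.
\<close>

lemma stops_within:
  assumes run: "md_run Q d gradf g gradg \<gamma> \<epsilon> \<Theta> x"
    and B: "\<And>u. u \<in> Q \<Longrightarrow> (norm (step_grad gradf g gradg \<epsilon> u))\<^sup>2 \<le> B"
    and N: "2 * \<Theta>\<^sup>2 * B / (\<gamma>\<^sup>2 * \<epsilon>\<^sup>2) * (1 + 1 / \<gamma>)\<^sup>2 \<le> real N"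
    and Bpos: "B > 0"
  obtains k where "stops_after gradf g gradg \<gamma> \<epsilon> \<Theta> x k" and "k \<le> N"
proof -
  let ?S = "stop_crit gradf g gradg \<gamma> \<epsilon> \<Theta> x"
  let ?p = "\<lambda>i. step_grad gradf g gradg \<epsilon> (x i)"
  have "\<exists>k\<le>N. ?S k"
  proof (rule ccontr)
    assume no: "\<not> (\<exists>k\<le>N. ?S k)"
    have x0: "x 0 \<in> Q" using run by (simp add: md_run_def)
    have step: "md_step Q d gradf g gradg \<gamma> \<epsilon> (x i) (x (Suc i))" if "i < N" for i
      using run no that by (simp add: md_run_def)
    have "1 / B \<le> 1 / (norm (?p i))\<^sup>2" if "i < N" for i
    proof (rule divide_left_mono)
      have "norm (?p i) \<noteq> 0" using step[OF that] by (simp add: md_step_def Let_def)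
      then show "0 < B * (norm (?p i))\<^sup>2" using Bpos by simp
      have "x i \<in> Q" by (rule md_steps_in[OF x0 step]) (use that in auto)
      then show "(norm (?p i))\<^sup>2 \<le> B" by (rule B)
    qed simp
    then have "(\<Sum>i<N. 1 / B) \<le> (\<Sum>i<N. 1 / (norm (?p i))\<^sup>2)"
      by (intro sum_mono) simp
    moreover have "2 * \<Theta>\<^sup>2 / (\<gamma>\<^sup>2 * \<epsilon>\<^sup>2) * (1 + 1 / \<gamma>)\<^sup>2 \<le> (\<Sum>i<N. 1 / B)"
      using N Bpos by (simp add: pos_le_divide_eq mult_ac)
    ultimately have "?S N" by (simp add: stop_crit_def)
    then show False using no by blast
  qed
  then obtain k0 where "k0 \<le> N" "?S k0" by blast
  moreover from this have "stops_after gradf g gradg \<gamma> \<epsilon> \<Theta> x (LEAST k. ?S k)"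
    by (auto simp: stops_after_def intro: LeastI dest: not_less_Least)
  ultimately show thesis using that Least_le[of ?S k0] by force
qed

text \<open>
  At the stopping time the sum of the \<open>1 / M\<^sub>i\<^sup>2\<close> exceeds what bad steps alone allow: the factor
  \<open>(1 + 1 / \<gamma>)\<^sup>2 > 1\<close> makes the excess strict.
\<close>

lemma stops_after_good_step:
  assumes d: "prox_function Q d" and g: "0 < \<gamma>" "\<gamma> \<le> 1" "0 < \<epsilon>"
    and qc: "quasar_convex_on \<gamma> xs Q f gradf"
    and sub: "\<And>u. u \<in> Q \<Longrightarrow> gradg u \<in> convex_subdiff Q g u"
    and xs: "xs \<in> Q" "g xs \<le> 0"
    and Th: "\<Theta> > 0" "\<And>u. u \<in> Q \<Longrightarrow> bregman Q d xs u \<le> \<Theta>\<^sup>2"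
    and run: "md_run Q d gradf g gradg \<gamma> \<epsilon> \<Theta> x"
    and stop: "stops_after gradf g gradg \<gamma> \<epsilon> \<Theta> x k"
  shows "\<exists>i \<in> productive g \<epsilon> x k. f (x i) - f xs < \<epsilon>"
proof (rule ccontr)
  assume "\<not> ?thesis"
  then have bad: "\<epsilon> \<le> f (x i) - f xs" if "i < k" "g (x i) \<le> \<epsilon>" for i
    using that by (force simp: productive_def)
  have x0: "x 0 \<in> Q" using run by (simp add: md_run_def)
  have step: "md_step Q d gradf g gradg \<gamma> \<epsilon> (x i) (x (Suc i))" if "i < k" for i
    using run stop that by (simp add: md_run_def stops_after_def)
  have xQ: "x i \<in> Q" if "i < k" for i
    by (rule md_steps_in[OF x0 step]) (use that in auto)
  let ?c = "2 * \<Theta>\<^sup>2 / (\<gamma>\<^sup>2 * \<epsilon>\<^sup>2)"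
  have "?c * (1 + 1 / \<gamma>)\<^sup>2 \<le> (\<Sum>i<k. 1 / (norm (step_grad gradf g gradg \<epsilon> (x i)))\<^sup>2)"
    using stop by (simp add: stops_after_def stop_crit_def)
  also have "\<dots> \<le> 2 * bregman Q d xs (x 0) / (\<gamma>\<^sup>2 * \<epsilon>\<^sup>2)"
    by (rule bad_steps_bound[OF d xs(1) g(1,3) x0 step])
       (simp_all add: bad_step_gap[OF g qc sub] xQ xs bad)
  also have "\<dots> \<le> ?c"
    using Th(2)[OF x0] by (intro divide_right_mono) auto
  finally have "?c * (1 + 1 / \<gamma>)\<^sup>2 \<le> ?c" .
  moreover have "?c > 0" using Th g by simp
  moreover have "(1 + 1 / \<gamma>)\<^sup>2 > 1" using g by (simp add: one_less_power)
  ultimately have "?c * 1 < ?c * (1 + 1 / \<gamma>)\<^sup>2" by (intro mult_strict_left_mono)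
  then show False using \<open>?c * (1 + 1 / \<gamma>)\<^sup>2 \<le> ?c\<close> by linarith
qed

theorem theorem4p2:
  fixes Q :: "'a::real_normed_vector set"
    and d f g :: "'a \<Rightarrow> real"
    and gradf gradg :: "'a \<Rightarrow> 'a \<Rightarrow>\<^sub>L real"
    and \<gamma> \<epsilon> \<Theta>\<^sub>0 M\<^sub>f M\<^sub>g :: real
    and xs :: 'a and x :: "nat \<Rightarrow> 'a"
  assumes "finite_dimensional TYPE('a)"
    and "closed Q" and "convex Q"
    and "prox_function Q d"
    and "0 < \<gamma>" and "\<gamma> \<le> 1"
    and "M\<^sub>f > 0" and "M\<^sub>f-lipschitz_on Q f"
    and "\<And>u. u \<in> Q \<Longrightarrow> gradf u \<in> clarke_subdiff Q f u"
    and "\<And>u. u \<in> Q \<Longrightarrow> norm (gradf u) \<le> M\<^sub>f"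
    and "quasar_convex_on \<gamma> xs Q f gradf"
    and "convex_on Q g"
    and "M\<^sub>g > 0" and "M\<^sub>g-lipschitz_on Q g"
    and "\<And>u. u \<in> Q \<Longrightarrow> gradg u \<in> convex_subdiff Q g u"
    and "\<And>u. u \<in> Q \<Longrightarrow> norm (gradg u) \<le> M\<^sub>g"
    and "is_arg_min f (\<lambda>u. u \<in> Q \<and> g u \<le> 0) xs"
    and "\<exists>xbar \<in> interior Q. g xbar \<le> 0"
    and "\<Theta>\<^sub>0 > 0" and "\<And>u v. u \<in> Q \<Longrightarrow> v \<in> Q \<Longrightarrow> bregman Q d v u \<le> \<Theta>\<^sub>0\<^sup>2"
    and "\<epsilon> > 0"
    and "md_run Q d gradf g gradg \<gamma> \<epsilon> \<Theta>\<^sub>0 x"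
  shows "\<exists>k. stops_after gradf g gradg \<gamma> \<epsilon> \<Theta>\<^sub>0 x k
    \<and> int k \<le> \<lceil>2 * \<Theta>\<^sub>0\<^sup>2 * max (M\<^sub>f\<^sup>2) (M\<^sub>g\<^sup>2) / (\<gamma>\<^sup>2 * \<epsilon>\<^sup>2) * (1 + 1 / \<gamma>)\<^sup>2\<rceil>
    \<and> productive g \<epsilon> x k \<noteq> {}
    \<and> md_output f g \<epsilon> x k \<noteq> {}
    \<and> (\<forall>xhat \<in> md_output f g \<epsilon> x k. f xhat - f xs \<le> \<epsilon> \<and> g xhat \<le> \<epsilon>)"
proof -
  let ?B = "max (M\<^sub>f\<^sup>2) (M\<^sub>g\<^sup>2)"
  let ?T = "2 * \<Theta>\<^sub>0\<^sup>2 * ?B / (\<gamma>\<^sup>2 * \<epsilon>\<^sup>2) * (1 + 1 / \<gamma>)\<^sup>2"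
  have xs: "xs \<in> Q" "g xs \<le> 0" using assms(17) by (auto simp: is_arg_min_def)
  have B: "(norm (step_grad gradf g gradg \<epsilon> u))\<^sup>2 \<le> ?B" if "u \<in> Q" for u
    using assms(10)[OF that] assms(16)[OF that]
    by (auto simp: step_grad_def le_max_iff_disj intro: power_mono)
  have Bpos: "?B > 0" using \<open>M\<^sub>f > 0\<close> by (simp add: less_max_iff_disj)
  have T: "?T \<le> real (nat \<lceil>?T\<rceil>)" by (rule real_nat_ceiling_ge)
  obtain k where stop: "stops_after gradf g gradg \<gamma> \<epsilon> \<Theta>\<^sub>0 x k" and k: "k \<le> nat \<lceil>?T\<rceil>"
    by (rule stops_within[OF assms(22) B T Bpos])
  have "0 \<le> ?T" by (simp add: max_def)
  then have "int k \<le> \<lceil>?T\<rceil>" using k by linarith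
  moreover obtain i where i: "i \<in> productive g \<epsilon> x k" "f (x i) - f xs < \<epsilon>"
    using stops_after_good_step[OF assms(4-6,21,11,15) xs assms(19) assms(20)[OF _ xs(1)]
        assms(22) stop] by blast
  moreover have "md_output f g \<epsilon> x k \<noteq> {}"
  proof -
    have "finite (x ` productive g \<epsilon> x k)" by (simp add: productive_def)
    from ex_is_arg_min_if_finite[OF this, of f] show ?thesis
      using i(1) by (auto simp: md_output_def)
  qed
  moreover have "f xhat - f xs \<le> \<epsilon> \<and> g xhat \<le> \<epsilon>" if "xhat \<in> md_output f g \<epsilon> x k" for xhat
  proof
    have "f xhat \<le> f (x i)" using that i(1) by (force simp: md_output_def is_arg_min_def)
    then show "f xhat - f xs \<le> \<epsilon>" using i(2) by simp
    show "g xhat \<le> \<epsilon>" using that by (auto simp: md_output_def is_arg_min_def productive_def)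
  qed
  ultimately show ?thesis using stop by blast
qed

end
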